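(* Let $\Lambda=kQ/I$ be a finite-dimensional clannish algebra in its standard presentation. Then there exists a complete skewed-gentle algebra $\Gamma=kQ^*/\langle\mathcal{R}^*\rangle$ with $Q_0^*=Q_0$ and with $Q^*$ containing $Q$ as a subquiver, such that $\Lambda$ is a quotient of $\Gamma$.
   Context: Conventions. $k$ is an algebraically closed field of characteristic zero; quivers $Q=(Q_0,Q_1)$ are finite and connected; the path $ba$ means first $a$, then $b$. Clannish algebras (standard presentation). Fix a subset $Q_1^{\mathrm{sp}}\subseteq Q_1$ of loops, called special loops; the other arrows are called ordinary. Let $\mathcal{R}^{\mathrm{sp}}=\{e^2-e \mid e\in Q_1^{\mathrm{sp}}\}$, let $\mathcal{I}$ be a set of zero-relations (paths of length at least two in $Q$), and let $I$ be the two-sided ideal of $kQ$ generated by $\mathcal{R}^{\mathrm{sp}}\cup\mathcal{I}$. The algebra $\Lambda=kQ/I$ (assumed finite-dimensional), given in this presentation, is clannish if: (C1) no path in $\mathcal{I}$ begins or ends with a special loop, or involves the square of a special loop; (C2) for each vertex $v$ there are at most two arrows with head $v$ and at most two arrows with tail $v$ (special loops are counted); (C3) for any ordinary arrow $b$ there is at most one arrow $a\in Q_1$ (with head of $a$ equal to tail of $b$) such that $ba\notin\mathcal{I}$, and at most one arrow $c\in Q_1$ (with tail of $c$ equal to head of $b$) such that $cb\notin\mathcal{I}$; here $a,c$ may be ordinary or special. Complete skewed-gentle algebras. Let $Q^*$ be a quiver with a distinguished set $Q_1^{*,\mathrm{sp}}$ of special loops (other arrows are ordinary), and let $\mathcal{R}^*=\mathcal{R}^*_{\mathrm{ord}}\cup\{e^2-e\mid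 e\in Q_1^{*,\mathrm{sp}}\}$, where $\mathcal{R}^*_{\mathrm{ord}}$ is a finite set of paths of length two in ordinary arrows. The triple, and the (possibly infinite-dimensional) algebra $kQ^*/\langle\mathcal{R}^*\rangle$, is called complete skewed-gentle if: (1) every vertex has exactly two incoming and two outgoing arrows, where a special loop counts as one incoming and one outgoing arrow; (2) every ordinary arrow belongs to a unique effective oriented cycle of ordinary arrows, i.e. a cyclic sequence, unique up to rotation, of pairwise distinct ordinary arrows in which every product of two cyclically consecutive arrows lies in $\mathcal{R}^*_{\mathrm{ord}}$; (3) for every ordinary arrow $a$ there is exactly one ordinary arrow $b$ with $ab\in\mathcal{R}^*_{\mathrm{ord}}$ and exactly one ordinary arrow $c$ with $ca\in\mathcal{R}^*_{\mathrm{ord}}$; (4) special loops satisfy only $e^2=e$, and no zero-relation starts or ends with a special loop. *)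

theory Defs
  imports
    "HOL-Computational_Algebra.Polynomial"
    "HOL-Library.Poly_Mapping"
    "HOL-Library.Sublist"
    "HOL-Algebra.QuotRing"
    "HOL-Algebra.Module"
    "Graph_Theory.Graph_Theory"
begin

section \<open>Quivers and path algebras\<close>

text \<open>
  Multi-digraphs with loops serve as quivers.  The constant \<open>connected\<close> of
  \<open>Graph_Theory\<close> refers to the underlying undirected graph and includes
  non-emptiness of the vertex set.
\<close>

locale quiver = fin_digraph Q for Q :: "('v, 'a) pre_digraph" +
  assumes connected: "Digraph_Component.connected Q"

text \<open>
  A path is a pair of its start vertex and the list of its arrows in the order in which they are
  traversed; \<open>(v, [])\<close> is the trivial path at \<open>v\<close>.  Thus the product \<open>ba\<close> (first \<open>a\<close>, then \<open>b\<close>)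
  is the list \<open>[a, b]\<close>.
\<close>

type_synonym ('v, 'a) qpath = "'v \<times> 'a list"

definition path_end :: "('v, 'a) pre_digraph \<Rightarrow> ('v, 'a) qpath \<Rightarrow> 'v" where
  "path_end Q p = pre_digraph.awlast Q (fst p) (snd p)"

definition paths :: "('v, 'a) pre_digraph \<Rightarrow> ('v, 'a) qpath set" where
  "paths Q = {p. pre_digraph.awalk Q (fst p) (snd p) (path_end Q p)}"

text \<open>The path algebra \<open>kQ\<close>: in a product \<open>f \<otimes> g\<close> the paths of \<open>g\<close> are traversed first.\<close>

definition path_algebra ::
  "('v, 'a) pre_digraph \<Rightarrow> ('k::field, ('v, 'a) qpath \<Rightarrow>\<^sub>0 'k) module" where
  "path_algebra Q =
     \<lparr>carrier = {f. Poly_Mapping.keys f \<subseteq> paths Q},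
      mult = (\<lambda>f g. \<Sum>q\<in>Poly_Mapping.keys f. \<Sum>p\<in>Poly_Mapping.keys g.
        if path_end Q p = fst q
        then Poly_Mapping.single (fst p, snd p @ snd q) (Poly_Mapping.lookup f q * Poly_Mapping.lookup g p) else 0),
      one = (\<Sum>v\<in>verts Q. Poly_Mapping.single (v, []) 1),
      zero = 0,
      add = (+),
      smult = (\<lambda>c. Poly_Mapping.map ((*) c))\<rparr>"

text \<open>The element of \<open>kQ\<close> given by a path of positive length.\<close>

definition path_elem ::
  "('v, 'a) pre_digraph \<Rightarrow> 'a list \<Rightarrow> ('v, 'a) qpath \<Rightarrow>\<^sub>0 'k::field" where
  "path_elem Q p = Poly_Mapping.single (tail Q (hd p), p) 1"


section \<open>Quotients of algebras\<close>

text \<open>The quotient ring \<open>A Quot I\<close> with the induced scalar multiplication.\<close>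

definition quot_algebra :: "('k, 'x) module \<Rightarrow> 'x set \<Rightarrow> ('k, 'x set) module" where
  "quot_algebra A I =
     ring.extend (A Quot I)
       (module.fields (\<lambda>c X. \<Union>x\<in>X. I +>\<^bsub>A\<^esub> (c \<odot>\<^bsub>A\<^esub> x)))"

definition algebra_isomorphic :: "('k, 'x) module \<Rightarrow> ('k, 'y) module \<Rightarrow> bool" where
  "algebra_isomorphic A B \<longleftrightarrow>
     (\<exists>h \<in> ring_iso A B. \<forall>c. \<forall>x\<in>carrier A. h (c \<odot>\<^bsub>A\<^esub> x) = c \<odot>\<^bsub>B\<^esub> h x)"

definition is_quotient_of :: "('k, 'y) module \<Rightarrow> ('k, 'x) module \<Rightarrow> bool" where
  "is_quotient_of B A \<longleftrightarrow> (\<exists>J. ideal J A \<and> algebra_isomorphic (quot_algebra A J) B)"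

definition finite_dimensional :: "('k, 'x) module \<Rightarrow> bool" where
  "finite_dimensional A \<longleftrightarrow>
     (\<exists>B. finite B \<and> B \<subseteq> carrier A \<and>
        (\<forall>x\<in>carrier A. \<exists>c. x = (\<Oplus>\<^bsub>A\<^esub>b\<in>B. c b \<odot>\<^bsub>A\<^esub> b)))"


section \<open>Algebras given by special loops and zero-relations\<close>

definition relations ::
  "('v, 'a) pre_digraph \<Rightarrow> 'a set \<Rightarrow> 'a list set \<Rightarrow> (('v, 'a) qpath \<Rightarrow>\<^sub>0 'k::field) set" where
  "relations Q Sp Z = {path_elem Q [e, e] - path_elem Q [e] | e. e \<in> Sp} \<union> path_elem Q ` Z"

definition presented_algebra ::
  "('v, 'a) pre_digraph \<Rightarrow> 'a set \<Rightarrow> 'a list set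
     \<Rightarrow> ('k::field, (('v, 'a) qpath \<Rightarrow>\<^sub>0 'k) set) module" where
  "presented_algebra Q Sp Z =
     quot_algebra (path_algebra Q) (Idl\<^bsub>path_algebra Q\<^esub> (relations Q Sp Z))"

locale quiver_with_special_loops = quiver Q for Q :: "('v, 'a) pre_digraph" +
  fixes Sp :: "'a set"
  assumes special_arcs: "Sp \<subseteq> arcs Q"
    and special_loop: "e \<in> Sp \<Longrightarrow> tail Q e = head Q e"
begin

abbreviation ordinary :: "'a set" where
  "ordinary \<equiv> arcs Q - Sp"

end

locale clannish = quiver_with_special_loops Q Sp
  for Q :: "('v, 'a) pre_digraph" and Sp +
  fixes Z :: "'a list set"
  assumes zero_relations:
      "p \<in> Z \<Longrightarrow> 2 \<le> length p \<and> (tail Q (hd p), p) \<in> paths Q"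
    and C1_ends: "p \<in> Z \<Longrightarrow> hd p \<notin> Sp \<and> last p \<notin> Sp"
    and C1_square: "\<lbrakk>p \<in> Z; e \<in> Sp\<rbrakk> \<Longrightarrow> \<not> sublist [e, e] p"
    and C2: "v \<in> verts Q \<Longrightarrow> in_degree Q v \<le> 2 \<and> out_degree Q v \<le> 2"
    and C3_before: "b \<in> ordinary \<Longrightarrow>
      \<exists>\<^sub>\<le>\<^sub>1 a. a \<in> arcs Q \<and> head Q a = tail Q b \<and> [a, b] \<notin> Z"
    and C3_after: "b \<in> ordinary \<Longrightarrow>
      \<exists>\<^sub>\<le>\<^sub>1 c. c \<in> arcs Q \<and> tail Q c = head Q b \<and> [b, c] \<notin> Z"

text \<open>
  A cyclic sequence is represented by a non-empty list, so that rotations of the list represent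
  the same cyclic sequence.  Lists of length one (a loop whose square is a relation) are allowed.
\<close>

definition effective_cycle :: "'a set \<Rightarrow> 'a list set \<Rightarrow> 'a list \<Rightarrow> bool" where
  "effective_cycle Ord R cs \<longleftrightarrow>
     cs \<noteq> [] \<and> distinct cs \<and> set cs \<subseteq> Ord \<and>
     (\<forall>i<length cs. [cs ! i, cs ! (Suc i mod length cs)] \<in> R)"

locale complete_skewed_gentle = quiver_with_special_loops Q Sp
  for Q :: "('v, 'a) pre_digraph" and Sp +
  fixes R :: "'a list set"
  assumes finite_relations: "finite R"
    and relations_length_two:
      "p \<in> R \<Longrightarrow> \<exists>a\<in>ordinary. \<exists>b\<in>ordinary. head Q a = tail Q b \<and> p = [a, b]"
    and degrees: "v \<in> verts Q \<Longrightarrow> in_degree Q v = 2 \<and> out_degree Q v = 2"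
    and unique_effective_cycle: "a \<in> ordinary \<Longrightarrow>
      \<exists>cs. effective_cycle ordinary R cs \<and> a \<in> set cs \<and>
        (\<forall>ds. effective_cycle ordinary R ds \<and> a \<in> set ds \<longrightarrow> (\<exists>m. ds = rotate m cs))"
    and unique_before: "a \<in> ordinary \<Longrightarrow> \<exists>!b. b \<in> ordinary \<and> [b, a] \<in> R"
    and unique_after: "a \<in> ordinary \<Longrightarrow> \<exists>!c. c \<in> ordinary \<and> [a, c] \<in> R"
    and special_ends: "p \<in> R \<Longrightarrow> hd p \<notin> Sp \<and> last p \<notin> Sp"

text \<open>
  \<open>Q\<close> is a subquiver of \<open>Q'\<close> after renaming its arrows along \<open>\<iota>\<close>.  The relation \<open>subgraph\<close> of
  \<open>Graph_Theory\<close> is too strict here: it compares the functions \<open>tail\<close> and \<open>head\<close> also outside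
  the arrows of \<open>Q\<close>.
\<close>

definition subquiver_via ::
  "('a \<Rightarrow> 'b) \<Rightarrow> ('v, 'a) pre_digraph \<Rightarrow> ('v, 'b) pre_digraph \<Rightarrow> bool" where
  "subquiver_via \<iota> Q Q' \<longleftrightarrow>
     verts Q \<subseteq> verts Q' \<and> inj_on \<iota> (arcs Q) \<and> \<iota> ` arcs Q \<subseteq> arcs Q' \<and>
     (\<forall>a\<in>arcs Q. tail Q' (\<iota> a) = tail Q a \<and> head Q' (\<iota> a) = head Q a)"

end

theory Submission
  imports Defs "HOL-Combinatorics.Cycles"
begin

text \<open>
  Since \<open>in_degree\<close> and \<open>out_degree\<close> have the same sum over all vertices, the quiver can be made
  2-regular by adding ordinary arrows.  At each vertex, (C3) says that the pairs of an incoming and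
  an outgoing ordinary arrow whose product is not a zero-relation form a partial matching in a
  bipartite graph with at most two vertices on either side, and no such pair remains when a special
  loop is present.  Hence there is a perfect matching by pairs whose product vanishes in \<open>\<Lambda>\<close>, where
  the new arrows are sent to zero.  These matchings form a permutation of the ordinary arrows, its
  graph is taken as the set of relations, and its cycles are the effective cycles.
\<close>

section \<open>First isomorphism theorem for rings that carry scalars\<close>

section \<open>Quotients of algebras\<close>

lemma quot_algebra_simps [simp]:
  "carrier (quot_algebra A I) = carrier (A Quot I)"
  "mult (quot_algebra A I) = mult (A Quot I)"
  "one (quot_algebra A I) = one (A Quot I)"
  "zero (quot_algebra A I) = zero (A Quot I)"
  "add (quot_algebra A I) = add (A Quot I)"
  "smult (quot_algebra A I) c X = (\<Union>x\<in>X. I +>\<^bsub>A\<^esub> (c \<odot>\<^bsub>A\<^esub> x))"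
  by (simp_all add: quot_algebra_def ring.defs module.defs)

text \<open>Being a ring depends only on the ring fields of a record. This carries the ring
  structure of \<open>A Quot I\<close> over to \<open>quot_algebra A I\<close>, a record with an
  additional scalar multiplication.\<close>

lemma ring_cong:
  assumes "ring R" and eq: "carrier S = carrier R" "mult S = mult R" "add S = add R"
    "one S = one R" "zero S = zero R"
  shows "ring S"
proof -
  interpret R: ring R by fact
  have "abelian_group S"
    by (rule abelian_groupI) (auto simp: eq R.a_ac intro: R.l_neg)
  moreover have "Group.monoid S"
    by (rule monoidI) (simp_all add: eq R.m_assoc)
  ultimately show ?thesis
    by (rule ringI) (simp_all add: eq R.l_distr R.r_distr)
qed

text \<open>
  Scalars act through multiples of \<open>\<one>\<close>, so that a unital ring homomorphism is linear as soon as it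
  is compatible with \<open>c \<odot> \<one>\<close>.
\<close>

locale unital_algebra = ring A for A :: "('k, 'x) module" (structure) +
  assumes scalar_closed [simp]: "c \<odot> \<one> \<in> carrier A"
    and smult_eq: "x \<in> carrier A \<Longrightarrow> c \<odot> x = (c \<odot> \<one>) \<otimes> x"
begin

lemma scalar_mult_closed [simp]: "x \<in> carrier A \<Longrightarrow> c \<odot> x \<in> carrier A"
  by (simp add: smult_eq[of x])

text \<open>Scalar multiplication on the quotient is a union over all representatives of a coset.
  Two representatives differ by some \<open>i\<close> in \<open>I\<close>, and scaling
  \<open>i\<close> by \<open>c\<close> amounts to multiplying it by a scalar multiple of the unit,
  which stays in \<open>I\<close>. So all members of the union are the same coset.\<close>

lemma smult_coset:
  assumes I: "ideal I A" and x: "x \<in> carrier A"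
  shows "c \<odot>\<^bsub>quot_algebra A I\<^esub> (I +> x) = I +> (c \<odot> x)"
proof -
  interpret I: ideal I A by fact
  have "I +> (c \<odot> y) = I +> (c \<odot> x)" if y: "y \<in> I +> x" for y
  proof -
    obtain i where i: "i \<in> I" "y = i \<oplus> x" using y by (auto simp: a_r_coset_def')
    then have iA: "i \<in> carrier A" using I.a_subset by auto
    have "c \<odot> y = (c \<odot> \<one>) \<otimes> i \<oplus> c \<odot> x"
      using i iA x by (simp add: smult_eq[of x] smult_eq[of "i \<oplus> x"] r_distr)
    moreover have "(c \<odot> \<one>) \<otimes> i \<in> I" using i by (simp add: I.I_l_closed)
    ultimately have "c \<odot> y \<in> I +> (c \<odot> x)" by (auto simp: a_r_coset_def')
    then show ?thesis
      using a_repr_independence[OF _ scalar_mult_closed[OF x] I.a_subgroup] by simp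
  qed
  moreover have "x \<in> I +> x" using I.a_rcos_self x by blast
  ultimately have "(\<Union>y\<in>I +> x. I +> (c \<odot> y)) = I +> (c \<odot> x)" by blast
  then show ?thesis by simp
qed

lemma carrier_quotE:
  assumes "X \<in> carrier (A Quot I)"
  obtains x where "x \<in> carrier A" "X = I +> x"
  using assms by (auto simp: FactRing_def A_RCOSETS_def')

lemma quot_unital_algebra:
  assumes I: "ideal I A"
  shows "unital_algebra (quot_algebra A I)"
proof -
  interpret I: ideal I A by fact
  have hom: "(+>) I \<in> ring_hom A (A Quot I)" by (rule I.rcos_ring_hom)
  have one: "\<one>\<^bsub>quot_algebra A I\<^esub> = I +> \<one>" by (simp add: FactRing_def)
  show ?thesis
  proof (rule unital_algebra.intro)
    show "ring (quot_algebra A I)" by (rule ring_cong[OF I.quotient_is_ring]) simp_all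
    show "unital_algebra_axioms (quot_algebra A I)"
    proof
      show "c \<odot>\<^bsub>quot_algebra A I\<^esub> \<one>\<^bsub>quot_algebra A I\<^esub> \<in> carrier (quot_algebra A I)" for c
        unfolding one smult_coset[OF I one_closed] using ring_hom_closed[OF hom] by simp
      fix X c assume "X \<in> carrier (quot_algebra A I)"
      then obtain x where x: "x \<in> carrier A" "X = I +> x" by (auto elim: carrier_quotE)
      show "c \<odot>\<^bsub>quot_algebra A I\<^esub> X
          = (c \<odot>\<^bsub>quot_algebra A I\<^esub> \<one>\<^bsub>quot_algebra A I\<^esub>) \<otimes>\<^bsub>quot_algebra A I\<^esub> X"
        unfolding one x(2) smult_coset[OF I one_closed] smult_coset[OF I x(1)]
        using ring_hom_mult[OF hom scalar_closed x(1)] smult_eq[OF x(1), of c] by simp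
    qed
  qed
qed

end

text \<open>A homomorphism that vanishes on \<open>I\<close> is constant on cosets of
  \<open>I\<close>. The induced map is written with \<open>the_elem\<close> to agree with the
  isomorphism given by \<open>FactRing_iso_set\<close>.\<close>

lemma (in ring_hom_ring) the_elem_image_coset:
  assumes "ideal I R" and zero: "\<And>i. i \<in> I \<Longrightarrow> h i = \<zero>\<^bsub>S\<^esub>" and x: "x \<in> carrier R"
  shows "the_elem (h ` (I +> x)) = h x"
proof -
  interpret I: ideal I R by fact
  have "h y = h x" if y: "y \<in> I +> x" for y
  proof -
    obtain i where "i \<in> I" "y = i \<oplus> x" using y by (auto simp: a_r_coset_def')
    then show ?thesis using zero[of i] I.Icarr[of i] x by simp
  qed
  then have "h ` (I +> x) \<subseteq> {h x}" by blast
  moreover have "h x \<in> h ` (I +> x)" using I.a_rcos_self[OF x] by (rule imageI)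
  ultimately have "h ` (I +> x) = {h x}" by (simp add: subset_singleton_iff) blast
  then show ?thesis by simp
qed

text \<open>The ideal is the kernel of \<open>h\<close>. The ring isomorphism from the first
  isomorphism theorem is linear because scalars act through multiples of the unit, which
  \<open>h\<close> preserves by \<open>scal\<close>.\<close>

lemma is_quotient_of_image:
  assumes "unital_algebra A" "unital_algebra B"
    and h: "h \<in> ring_hom A B" "h ` carrier A = carrier B"
    and scal: "\<And>c. h (c \<odot>\<^bsub>A\<^esub> \<one>\<^bsub>A\<^esub>) = c \<odot>\<^bsub>B\<^esub> \<one>\<^bsub>B\<^esub>"
  shows "is_quotient_of B A"
proof -
  interpret A: unital_algebra A by fact
  interpret B: unital_algebra B by fact
  interpret h: ring_hom_ring A B h
    by (rule ring_hom_ringI2[OF A.ring_axioms B.ring_axioms h(1)])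
  define J where "J = a_kernel A B h"
  have J: "ideal J A" unfolding J_def by (rule h.kernel_is_ideal)
  interpret J: ideal J A by fact
  have zero: "h i = \<zero>\<^bsub>B\<^esub>" if "i \<in> J" for i
    using that unfolding J_def a_kernel_def' by blast
  define g where "g = (\<lambda>X. the_elem (h ` X))"
  have iso: "g \<in> ring_iso (A Quot J) B"
    unfolding g_def J_def by (rule h.FactRing_iso_set[OF h(2)])
  have g: "g (J +>\<^bsub>A\<^esub> x) = h x" if "x \<in> carrier A" for x
    unfolding g_def by (rule h.the_elem_image_coset[OF J zero that])
  have smult: "g (c \<odot>\<^bsub>quot_algebra A J\<^esub> X) = c \<odot>\<^bsub>B\<^esub> g X"
    if X: "X \<in> carrier (quot_algebra A J)" for c X
  proof -
    obtain x where x: "x \<in> carrier A" "X = J +>\<^bsub>A\<^esub> x"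
      using X by (auto elim: A.carrier_quotE)
    have "h (c \<odot>\<^bsub>A\<^esub> x) = c \<odot>\<^bsub>B\<^esub> h x"
      unfolding A.smult_eq[OF x(1), of c] B.smult_eq[OF h.hom_closed[OF x(1)], of c]
      using x(1) by (simp add: scal)
    then show ?thesis unfolding x(2) A.smult_coset[OF J x(1)] using x by (simp add: g)
  qed
  \<comment> \<open>\<open>quot_algebra A J\<close> and \<open>A Quot J\<close> have the same ring
    fields, so unfolding identifies the two statements.\<close>
  have "g \<in> ring_iso (quot_algebra A J) B"
    using iso unfolding ring_iso_def ring_hom_def quot_algebra_simps .
  then have "algebra_isomorphic (quot_algebra A J) B"
    unfolding algebra_isomorphic_def by (intro bexI[of _ g] allI ballI smult)
  then show ?thesis
    unfolding is_quotient_of_def by (intro exI[of _ J] conjI J)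
qed

text \<open>Since \<open>h\<close> vanishes on \<open>I\<close>, it factors through a surjection
  \<open>g\<close> from the quotient by \<open>I\<close>, to which
  \<open>is_quotient_of_image\<close> applies.\<close>

lemma is_quotient_of_quot_algebra:
  assumes "unital_algebra A" "unital_algebra B" and I: "ideal I A"
    and h: "h \<in> ring_hom A B" "h ` carrier A = carrier B"
    and scal: "\<And>c. h (c \<odot>\<^bsub>A\<^esub> \<one>\<^bsub>A\<^esub>) = c \<odot>\<^bsub>B\<^esub> \<one>\<^bsub>B\<^esub>"
    and zero: "\<And>x. x \<in> I \<Longrightarrow> h x = \<zero>\<^bsub>B\<^esub>"
  shows "is_quotient_of B (quot_algebra A I)"
proof -
  interpret A: unital_algebra A by fact
  interpret B: unital_algebra B by fact
  interpret I: ideal I A by fact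
  interpret h: ring_hom_ring A B h
    by (rule ring_hom_ringI2[OF A.ring_axioms B.ring_axioms h(1)])
  define g where "g = (\<lambda>X. the_elem (h ` X))"
  have g: "g (I +>\<^bsub>A\<^esub> x) = h x" if "x \<in> carrier A" for x
    unfolding g_def by (rule h.the_elem_image_coset[OF I zero that])
  have quot: "(+>\<^bsub>A\<^esub>) I \<in> ring_hom A (A Quot I)" by (rule I.rcos_ring_hom)
  have carr: "carrier (A Quot I) = (+>\<^bsub>A\<^esub>) I ` carrier A"
    by (auto simp: FactRing_def A_RCOSETS_def')
  have one: "\<one>\<^bsub>A Quot I\<^esub> = I +>\<^bsub>A\<^esub> \<one>\<^bsub>A\<^esub>" by (simp add: FactRing_def)
  show ?thesis
  proof (rule is_quotient_of_image)
    show "unital_algebra (quot_algebra A I)" by (rule A.quot_unital_algebra[OF I])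
    show "unital_algebra B" by fact
    show "g \<in> ring_hom (quot_algebra A I) B"
      by (rule ring_hom_memI)
        (auto simp: carr one g ring_hom_mult[OF quot, symmetric] ring_hom_add[OF quot, symmetric])
    show "g ` carrier (quot_algebra A I) = carrier B"
      using h(2) by (simp add: carr image_image g)
    show "g (c \<odot>\<^bsub>quot_algebra A I\<^esub> \<one>\<^bsub>quot_algebra A I\<^esub>) = c \<odot>\<^bsub>B\<^esub> \<one>\<^bsub>B\<^esub>" for c
      using A.smult_coset[OF I A.one_closed, of c] g[OF A.scalar_closed] scal by (simp add: one)
  qed
qed

section \<open>The path algebra\<close>

text \<open>Reduces additive identities to monomials. The \<open>single\<close> case is limited to
  keys of \<open>f\<close>, so that a bound such as \<open>keys f\<close> inside
  \<open>paths Q\<close> remains available there.\<close>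

lemma single_combination_induct [case_names zero single add]:
  fixes f :: "'a \<Rightarrow>\<^sub>0 'b::comm_monoid_add"
  assumes "P 0" "\<And>k c. k \<in> Poly_Mapping.keys f \<Longrightarrow> P (Poly_Mapping.single k c)" "\<And>g h. P g \<Longrightarrow> P h \<Longrightarrow> P (g + h)"
  shows "P f"
proof -
  have "P (\<Sum>k\<in>A. Poly_Mapping.single k (Poly_Mapping.lookup f k))"
    if "finite A" "A \<subseteq> Poly_Mapping.keys f" for A
    using that by induction (auto intro: assms)
  moreover have "f = (\<Sum>k\<in>Poly_Mapping.keys f. Poly_Mapping.single k (Poly_Mapping.lookup f k))"
    by (rule poly_mapping_eqI) (auto simp: lookup_sum lookup_single when_def not_in_keys_iff_lookup_eq_zero)
  ultimately show ?thesis by (metis finite_keys order_refl)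
qed

section \<open>End vertices and concatenation of paths\<close>

lemma path_end_Nil [simp]: "path_end Q (v, []) = v"
  by (simp add: path_end_def pre_digraph.awalk_verts.simps)

lemma path_end_Cons [simp]: "path_end Q (v, a # p) = path_end Q (head Q a, p)"
  by (cases p) (simp_all add: path_end_def pre_digraph.awalk_verts.simps)

lemma path_end_append: "path_end Q (v, p @ q) = path_end Q (path_end Q (v, p), q)"
  by (induction p arbitrary: v) simp_all

lemma Nil_mem_paths_iff [simp]: "(v, []) \<in> paths Q \<longleftrightarrow> v \<in> verts Q"
  by (simp add: paths_def pre_digraph.awalk_def pre_digraph.cas.simps)

lemma Cons_mem_paths_iff [simp]:
  "(v, a # p) \<in> paths Q \<longleftrightarrow>
     v \<in> verts Q \<and> a \<in> arcs Q \<and> tail Q a = v \<and> set p \<subseteq> arcs Q \<and> pre_digraph.cas Q (head Q a) p (path_end Q (head Q a, p))"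
  by (auto simp: paths_def pre_digraph.awalk_def pre_digraph.cas.simps)

lemma mem_paths_iff:
  "(v, p) \<in> paths Q \<longleftrightarrow> v \<in> verts Q \<and> set p \<subseteq> arcs Q \<and> pre_digraph.cas Q v p (path_end Q (v, p))"
  by (auto simp: paths_def pre_digraph.awalk_def)

lemma cas_append:
  "pre_digraph.cas Q v (p @ q) w \<longleftrightarrow>
    pre_digraph.cas Q v p (path_end Q (v, p)) \<and> pre_digraph.cas Q (path_end Q (v, p)) q w"
  by (induction p arbitrary: v) (auto simp: pre_digraph.cas.simps)

lemma append_mem_paths:
  assumes "(v, p) \<in> paths Q" "(path_end Q (v, p), q) \<in> paths Q"
  shows "(v, p @ q) \<in> paths Q"
  using assms by (auto simp: mem_paths_iff cas_append path_end_append)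

lemma path_end_mem_verts:
  assumes "wf_digraph Q" "(v, p) \<in> paths Q"
  shows "path_end Q (v, p) \<in> verts Q"
  using assms(2)
  by (induction p arbitrary: v)
    (auto simp: mem_paths_iff pre_digraph.cas.simps wf_digraph.head_in_verts[OF assms(1)])

section \<open>Multiplication and scalars in the path algebra\<close>

lemma path_algebra_simps [simp]:
  "carrier (path_algebra Q) = {f. Poly_Mapping.keys f \<subseteq> paths Q}"
  "one (path_algebra Q) = (\<Sum>v\<in>verts Q. Poly_Mapping.single (v, []) 1)"
  "zero (path_algebra Q) = 0"
  "add (path_algebra Q) = (+)"
  "smult (path_algebra Q) = (\<lambda>c. Poly_Mapping.map ((*) c))"
  by (simp_all add: path_algebra_def)

text \<open>Enlarging the index sets only adds terms with coefficient zero. This is needed for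
  distributivity: cancellation can make the keys of a sum smaller than the union of the keys, so all
  products are expanded over one common set.\<close>

lemma path_mult_sum:
  assumes "finite A" "Poly_Mapping.keys f \<subseteq> A" "finite B" "Poly_Mapping.keys g \<subseteq> B"
  shows "f \<otimes>\<^bsub>path_algebra Q\<^esub> g = (\<Sum>q\<in>A. \<Sum>p\<in>B.
    if path_end Q p = fst q
    then Poly_Mapping.single (fst p, snd p @ snd q) (Poly_Mapping.lookup f q * Poly_Mapping.lookup g p) else 0)"
    (is "_ = (\<Sum>q\<in>A. \<Sum>p\<in>B. ?t q p)")
proof -
  have "f \<otimes>\<^bsub>path_algebra Q\<^esub> g = (\<Sum>q\<in>Poly_Mapping.keys f. \<Sum>p\<in>Poly_Mapping.keys g. ?t q p)"
    by (simp add: path_algebra_def)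
  also have "\<dots> = (\<Sum>q\<in>Poly_Mapping.keys f. \<Sum>p\<in>B. ?t q p)"
    by (intro sum.cong refl sum.mono_neutral_left assms)
      (auto simp: not_in_keys_iff_lookup_eq_zero)
  also have "\<dots> = (\<Sum>q\<in>A. \<Sum>p\<in>B. ?t q p)"
    by (intro sum.mono_neutral_left assms)
      (auto simp: not_in_keys_iff_lookup_eq_zero intro!: sum.neutral)
  finally show ?thesis .
qed

lemma path_mult_single:
  "Poly_Mapping.single q a \<otimes>\<^bsub>path_algebra Q\<^esub> Poly_Mapping.single p b =
    (if path_end Q p = fst q then Poly_Mapping.single (fst p, snd p @ snd q) (a * b) else 0)"
  by (subst path_mult_sum[of "{q}" _ "{p}"]) simp_all

lemma path_mult_zero [simp]:
  "0 \<otimes>\<^bsub>path_algebra Q\<^esub> g = 0" "f \<otimes>\<^bsub>path_algebra Q\<^esub> 0 = 0"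
  by (simp_all add: path_algebra_def)

lemma path_mult_add_left:
  "(f + f') \<otimes>\<^bsub>path_algebra Q\<^esub> g = f \<otimes>\<^bsub>path_algebra Q\<^esub> g + f' \<otimes>\<^bsub>path_algebra Q\<^esub> g"
proof -
  define A where "A = Poly_Mapping.keys f \<union> Poly_Mapping.keys f'"
  have A: "finite A" "Poly_Mapping.keys f \<subseteq> A" "Poly_Mapping.keys f' \<subseteq> A" "Poly_Mapping.keys (f + f') \<subseteq> A"
    using Poly_Mapping.keys_add[of f f'] by (auto simp: A_def)
  show ?thesis
    unfolding path_mult_sum[OF A(1,2) finite_keys order_refl] path_mult_sum[OF A(1,3) finite_keys order_refl]
      path_mult_sum[OF A(1,4) finite_keys order_refl] sum.distrib[symmetric]
    by (intro sum.cong refl) (auto simp: lookup_add ring_distribs single_add)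
qed

lemma path_mult_add_right:
  "f \<otimes>\<^bsub>path_algebra Q\<^esub> (g + g') = f \<otimes>\<^bsub>path_algebra Q\<^esub> g + f \<otimes>\<^bsub>path_algebra Q\<^esub> g'"
proof -
  define A where "A = Poly_Mapping.keys g \<union> Poly_Mapping.keys g'"
  have A: "finite A" "Poly_Mapping.keys g \<subseteq> A" "Poly_Mapping.keys g' \<subseteq> A" "Poly_Mapping.keys (g + g') \<subseteq> A"
    using Poly_Mapping.keys_add[of g g'] by (auto simp: A_def)
  show ?thesis
    unfolding path_mult_sum[OF finite_keys order_refl A(1,2)] path_mult_sum[OF finite_keys order_refl A(1,3)]
      path_mult_sum[OF finite_keys order_refl A(1,4)] sum.distrib[symmetric]
    by (intro sum.cong refl) (auto simp: lookup_add ring_distribs single_add)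
qed

lemma path_mult_sum_left:
  "(\<Sum>i\<in>S. F i) \<otimes>\<^bsub>path_algebra Q\<^esub> g = (\<Sum>i\<in>S. F i \<otimes>\<^bsub>path_algebra Q\<^esub> g)"
  by (induction S rule: infinite_finite_induct) (auto simp: path_mult_add_left)

lemma path_mult_sum_right:
  "f \<otimes>\<^bsub>path_algebra Q\<^esub> (\<Sum>i\<in>S. G i) = (\<Sum>i\<in>S. f \<otimes>\<^bsub>path_algebra Q\<^esub> G i)"
  by (induction S rule: infinite_finite_induct) (auto simp: path_mult_add_right)

text \<open>Both sides are additive in each argument, so three monomials suffice. For these, either
  bracketing is the concatenated path if the consecutive end points match, and zero
  otherwise.\<close>

lemma path_mult_assoc:
  "f \<otimes>\<^bsub>path_algebra Q\<^esub> g \<otimes>\<^bsub>path_algebra Q\<^esub> h =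
    f \<otimes>\<^bsub>path_algebra Q\<^esub> (g \<otimes>\<^bsub>path_algebra Q\<^esub> h)"
proof (induction f rule: single_combination_induct)
  case (single k a)
  show ?case
  proof (induction g rule: single_combination_induct)
    case (single l b)
    show ?case
    proof (induction h rule: single_combination_induct)
      case (single m c)
      show ?case
        by (cases k; cases l; cases m) (auto simp: path_mult_single path_end_append mult.assoc)
    qed (simp_all add: path_mult_add_right)
  qed (simp_all add: path_mult_add_left path_mult_add_right)
qed (simp_all add: path_mult_add_left)

lemma path_mult_closed:
  assumes "Poly_Mapping.keys f \<subseteq> paths Q" "Poly_Mapping.keys g \<subseteq> paths Q"
  shows "Poly_Mapping.keys (f \<otimes>\<^bsub>path_algebra Q\<^esub> g) \<subseteq> paths Q"
proof (induction f rule: single_combination_induct)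
  case (single k a)
  then have k: "k \<in> paths Q" using assms by auto
  show ?case
  proof (induction g rule: single_combination_induct)
    case (single l b)
    then have l: "l \<in> paths Q" using assms by auto
    show ?case
      using k l append_mem_paths[of "fst l" "snd l" Q "snd k"]
      by (cases k; cases l) (auto simp: path_mult_single)
  next
    case (add g h)
    then show ?case using Poly_Mapping.keys_add by (fastforce simp: path_mult_add_right)
  qed simp
next
  case (add g h)
  then show ?case using Poly_Mapping.keys_add by (fastforce simp: path_mult_add_left)
qed simp

lemma map_times_zero [simp]: "Poly_Mapping.map ((*) (c::'k::field)) 0 = 0"
  by (simp add: map_eq_zero_iff)

lemma map_times_one: "Poly_Mapping.map ((*) (1::'k::field)) f = f"
  by (rule poly_mapping_eqI) (simp add: map.rep_eq when_def)

lemma map_times_add: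
  "Poly_Mapping.map ((*) (c::'k::field)) (f + g) = Poly_Mapping.map ((*) c) f + Poly_Mapping.map ((*) c) g"
  by (rule poly_mapping_eqI) (auto simp: map.rep_eq lookup_add when_def simp flip: distrib_left)

lemma path_smult_one:
  "Poly_Mapping.map ((*) c) (\<Sum>v\<in>V. Poly_Mapping.single (v, []) 1)
    = (\<Sum>v\<in>V. Poly_Mapping.single (v, []) (c::'k::field))"
  by (induction V rule: infinite_finite_induct) (simp_all add: map_times_add)

text \<open>Left multiplication by a trivial path keeps exactly the paths ending at its vertex, so
  for each key of \<open>f\<close> a single summand survives, the one at its end vertex.\<close>

lemma path_smult_eq:
  fixes f :: "('v, 'a) qpath \<Rightarrow>\<^sub>0 'k::field"
  assumes "finite (verts Q)" and f: "Poly_Mapping.keys f \<subseteq> paths Q" and "wf_digraph Q"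
  shows "(\<Sum>v\<in>verts Q. Poly_Mapping.single (v, []) c) \<otimes>\<^bsub>path_algebra Q\<^esub> f = Poly_Mapping.map ((*) c) f"
proof (induction f rule: single_combination_induct)
  case (single k a)
  then have "path_end Q k \<in> verts Q"
    using f path_end_mem_verts[OF assms(3)] by (metis prod.collapse subsetD)
  then show ?case
    using assms(1) by (simp add: path_mult_sum_left path_mult_single)
qed (simp_all add: path_mult_add_right map_times_add)

lemma path_mult_one_right:
  fixes f :: "('v, 'a) qpath \<Rightarrow>\<^sub>0 'k::field"
  assumes "finite (verts Q)" and f: "Poly_Mapping.keys f \<subseteq> paths Q"
  shows "f \<otimes>\<^bsub>path_algebra Q\<^esub> (\<Sum>v\<in>verts Q. Poly_Mapping.single (v, []) 1) = f"
proof (induction f rule: single_combination_induct)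
  case (single k a)
  then have "fst k \<in> verts Q"
    using f mem_paths_iff by (metis prod.collapse subsetD)
  then show ?case
    using assms(1) by (cases k) (simp add: path_mult_sum_right path_mult_single)
qed (simp_all add: path_mult_add_left)

lemma unital_algebra_path_algebra:
  assumes "fin_digraph Q"
  shows "unital_algebra (path_algebra Q :: ('k::field, _) module)"
proof -
  interpret fin_digraph Q by fact
  let ?A = "path_algebra Q :: ('k, _) module"
  have one_closed: "(\<Sum>v\<in>verts Q. Poly_Mapping.single (v, []) c) \<in> carrier ?A" for c :: 'k
    using Poly_Mapping.keys_sum[of "\<lambda>v. Poly_Mapping.single (v, []) c" "verts Q"]
    by (fastforce split: if_splits)
  show ?thesis
  proof (rule unital_algebra.intro)
    have "abelian_group ?A"
    proof (rule abelian_groupI)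
      show "\<exists>y\<in>carrier ?A. y \<oplus>\<^bsub>?A\<^esub> x = \<zero>\<^bsub>?A\<^esub>" if "x \<in> carrier ?A" for x
        using that by (intro bexI[of _ "- x"]) auto
      show "x \<oplus>\<^bsub>?A\<^esub> y \<in> carrier ?A" if "x \<in> carrier ?A" "y \<in> carrier ?A" for x y
        using that Poly_Mapping.keys_add[of x y] by auto
    qed (simp_all add: add_ac)
    \<comment> \<open>The left unit law is \<open>path_smult_eq\<close> for the scalar 1.\<close>
    moreover have "Group.monoid ?A"
      by (rule monoidI)
        (use path_mult_closed one_closed[of 1] path_mult_one_right[of Q] path_smult_eq[of Q _ 1]
          wf_digraph_axioms in \<open>simp_all add: path_mult_assoc map_times_one\<close>)
    ultimately show "ring ?A"
      by (rule ringI) (simp_all add: path_mult_add_left path_mult_add_right)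
    show "unital_algebra_axioms ?A"
      by (unfold_locales)
        (use one_closed in \<open>simp_all add: path_smult_one path_smult_eq wf_digraph_axioms\<close>)
  qed
qed

section \<open>Restriction of path algebras to a subquiver with the same vertices\<close>

locale quiver_embedding =
  fixes \<iota> :: "'a \<Rightarrow> 'b" and Q :: "('v, 'a) pre_digraph" and Q' :: "('v, 'b) pre_digraph"
  assumes inj: "inj \<iota>"
    and verts_eq: "verts Q' = verts Q"
    and arcs_eq: "\<iota> -` arcs Q' = arcs Q"
    and tail_eq: "a \<in> arcs Q \<Longrightarrow> tail Q' (\<iota> a) = tail Q a"
    and head_eq: "a \<in> arcs Q \<Longrightarrow> head Q' (\<iota> a) = head Q a"
begin

definition lift_path :: "('v, 'a) qpath \<Rightarrow> ('v, 'b) qpath" where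
  "lift_path p = (fst p, map \<iota> (snd p))"

lemma lift_path_Pair [simp]: "lift_path (v, p) = (v, map \<iota> p)"
  by (simp add: lift_path_def)

text \<open>The map \<open>kQ' \<rightarrow> kQ\<close> that kills every path through an arrow outside the image of \<open>\<iota>\<close>.\<close>

abbreviation restrict_paths :: "(('v, 'b) qpath \<Rightarrow>\<^sub>0 'k::field) \<Rightarrow> ('v, 'a) qpath \<Rightarrow>\<^sub>0 'k" where
  "restrict_paths \<equiv> Poly_Mapping.map_key lift_path"

text \<open>\<open>map_key\<close> behaves as reindexing only along a function that is injective on
  its whole type, hence the global assumption on \<open>\<iota>\<close>.\<close>

lemma inj_lift_path: "inj lift_path"
  by (auto intro!: injI simp: lift_path_def prod_eq_iff inj_map_eq_map[OF inj])

lemma mem_range_lift_path_iff: "(v, p) \<in> range lift_path \<longleftrightarrow> set p \<subseteq> range \<iota>"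
proof
  assume "set p \<subseteq> range \<iota>"
  then have "p \<in> range (map \<iota>)" by (metis lists_UNIV lists_image in_listsI subsetD)
  then show "(v, p) \<in> range lift_path" by (auto simp: image_iff)
qed (auto simp: lift_path_def)

lemma lookup_restrict: "Poly_Mapping.lookup (restrict_paths f) p = Poly_Mapping.lookup f (lift_path p)"
  by (simp add: map_key.rep_eq inj_lift_path)

lemma restrict_zero [simp]: "restrict_paths 0 = 0"
  by (rule map_key_zero[OF inj_lift_path])

lemma restrict_add: "restrict_paths (f + g) = restrict_paths f + restrict_paths g"
  by (rule map_key_plus[OF inj_lift_path])

lemma restrict_sum: "restrict_paths (\<Sum>i\<in>S. F i) = (\<Sum>i\<in>S. restrict_paths (F i))"
  by (rule poly_mapping_eqI) (simp add: lookup_restrict lookup_sum)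

lemma restrict_diff: "restrict_paths (f - g) = restrict_paths f - restrict_paths g"
  by (rule poly_mapping_eqI) (simp add: lookup_restrict lookup_minus)

lemma restrict_single_lift [simp]:
  "restrict_paths (Poly_Mapping.single (v, map \<iota> p) c) = Poly_Mapping.single (v, p) c"
  using map_key_single[OF inj_lift_path, of "(v, p)" c] by simp

lemma restrict_single_outside:
  assumes "\<not> set p \<subseteq> range \<iota>"
  shows "restrict_paths (Poly_Mapping.single (v, p) c) = 0"
proof -
  have "(v, p) \<noteq> lift_path k" for k
    using assms mem_range_lift_path_iff[of v p] by (metis rangeI)
  then show ?thesis
    by (intro poly_mapping_eqI) (simp add: lookup_restrict lookup_single when_def)
qed

lemma path_end_lift:
  assumes "set p \<subseteq> arcs Q"
  shows "path_end Q' (v, map \<iota> p) = path_end Q (v, p)"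
  using assms by (induction p arbitrary: v) (auto simp: head_eq)

lemma cas_lift:
  assumes "set p \<subseteq> arcs Q"
  shows "pre_digraph.cas Q' v (map \<iota> p) w \<longleftrightarrow> pre_digraph.cas Q v p w"
  using assms by (induction p arbitrary: v) (auto simp: head_eq tail_eq pre_digraph.cas.simps)

text \<open>As \<open>arcs_eq\<close> is stated with a preimage, \<open>\<iota>\<close> also
  reflects being an arrow; therefore nothing has to be assumed about \<open>p\<close>.\<close>

lemma lift_path_mem_paths_iff [simp]: "(v, map \<iota> p) \<in> paths Q' \<longleftrightarrow> (v, p) \<in> paths Q"
proof -
  have "set (map \<iota> p) \<subseteq> arcs Q' \<longleftrightarrow> set p \<subseteq> arcs Q" using arcs_eq by auto
  then show ?thesis by (auto simp: mem_paths_iff verts_eq cas_lift path_end_lift)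
qed

text \<open>On monomials: a concatenation avoids the arrows outside the range of
  \<open>\<iota>\<close> iff both factors do, so otherwise both sides vanish. If both factors are
  lifted, the end vertex that decides whether they compose is the same in \<open>Q'\<close> and in
  \<open>Q\<close>.\<close>

lemma restrict_mult:
  assumes "Poly_Mapping.keys f \<subseteq> paths Q'" "Poly_Mapping.keys g \<subseteq> paths Q'"
  shows "restrict_paths (f \<otimes>\<^bsub>path_algebra Q'\<^esub> g)
    = restrict_paths f \<otimes>\<^bsub>path_algebra Q\<^esub> restrict_paths g"
proof (induction f rule: single_combination_induct)
  case (single k a)
  then have k: "k \<in> paths Q'" using assms by auto
  obtain v p where vp: "k = (v, p)" by (cases k)
  show ?case
  proof (induction g rule: single_combination_induct)
    case (single l b)
    then have l: "l \<in> paths Q'" using assms by auto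
    obtain w q where wq: "l = (w, q)" by (cases l)
    show ?case
    proof (cases "set p \<subseteq> range \<iota> \<and> set q \<subseteq> range \<iota>")
      case True
      then obtain p' q' where pq: "p = map \<iota> p'" "q = map \<iota> q'"
        using mem_range_lift_path_iff[of v p] mem_range_lift_path_iff[of w q] by auto
      have "(w, q') \<in> paths Q" using l wq pq by simp
      then have "path_end Q' l = path_end Q (w, q')"
        using path_end_lift[of q' w] by (simp add: wq pq mem_paths_iff)
      then show ?thesis
        using restrict_single_lift[of w "q' @ p'" "a * b"] by (simp add: path_mult_single vp wq pq)
    next
      case False
      then have "\<not> set (q @ p) \<subseteq> range \<iota>" by auto
      then have "restrict_paths (Poly_Mapping.single k a \<otimes>\<^bsub>path_algebra Q'\<^esub> Poly_Mapping.single l b) = 0"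
        by (simp add: path_mult_single vp wq restrict_single_outside)
      moreover have "restrict_paths (Poly_Mapping.single k a) = 0 \<or> restrict_paths (Poly_Mapping.single l b) = 0"
        using False restrict_single_outside unfolding vp wq by blast
      ultimately show ?thesis by auto
    qed
  qed (simp_all add: path_mult_add_right restrict_add)
qed (simp_all add: path_mult_add_left restrict_add)

lemma restrict_ring_hom:
  "restrict_paths \<in> ring_hom (path_algebra Q' :: ('k::field, _) module) (path_algebra Q)"
proof (rule ring_hom_memI)
  fix f :: "('v, 'b) qpath \<Rightarrow>\<^sub>0 'k"
  assume "f \<in> carrier (path_algebra Q')"
  then show "restrict_paths f \<in> carrier (path_algebra Q)"
    by (auto simp: keys_map_key inj_lift_path)
next
  have "restrict_paths (Poly_Mapping.single (v, []) 1) = Poly_Mapping.single (v, []) (1::'k)" for v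
    using restrict_single_lift[of v "[]"] by simp
  then show "restrict_paths \<one>\<^bsub>path_algebra Q'\<^esub> = \<one>\<^bsub>path_algebra Q :: ('k, _) module\<^esub>"
    by (simp add: restrict_sum verts_eq)
qed (simp_all add: restrict_mult restrict_add)

lemma restrict_surj:
  "restrict_paths ` carrier (path_algebra Q' :: ('k::field, _) module) = carrier (path_algebra Q)"
proof
  show "restrict_paths ` carrier (path_algebra Q' :: ('k, _) module) \<subseteq> carrier (path_algebra Q)"
    using ring_hom_closed[OF restrict_ring_hom] by blast
  show "carrier (path_algebra Q) \<subseteq> restrict_paths ` carrier (path_algebra Q' :: ('k, _) module)"
  proof
    fix f :: "('v, 'a) qpath \<Rightarrow>\<^sub>0 'k"
    assume f: "f \<in> carrier (path_algebra Q)"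
    show "f \<in> restrict_paths ` carrier (path_algebra Q')"
    proof (induction f rule: single_combination_induct)
      case zero
      show ?case by (intro image_eqI[of _ _ 0]) simp_all
    next
      case (single k c)
      then have "k \<in> paths Q" using f by auto
      then show ?case
        by (cases k) (auto intro!: image_eqI[of _ _ "Poly_Mapping.single (lift_path k) c"] split: if_splits)
    next
      case (add g h)
      then obtain g' h' where "g = restrict_paths g'" "h = restrict_paths h'"
        "g' \<in> carrier (path_algebra Q')" "h' \<in> carrier (path_algebra Q')" by blast
      then show ?case using Poly_Mapping.keys_add[of g' h']
        by (intro image_eqI[of _ _ "g' + h'"]) (auto simp: restrict_add)
    qed
  qed
qed

lemma restrict_smult:
  "restrict_paths (Poly_Mapping.map ((*) c) f) = Poly_Mapping.map ((*) c) (restrict_paths f)"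
  by (rule poly_mapping_eqI) (simp add: lookup_restrict map.rep_eq)

end

lemma ideal_coset_eq_self:
  assumes "ideal I R" "x \<in> I" shows "I +>\<^bsub>R\<^esub> x = I"
proof -
  interpret ideal I R by fact
  show ?thesis using assms(2) a_subgroup a_subset by (intro a_coset_join2) auto
qed

text \<open>Restriction followed by the projection is a surjective homomorphism whose kernel is an
  ideal. By \<open>restr\<close> the kernel contains the relations of \<open>Q'\<close>, hence also
  the ideal that they generate.\<close>

lemma (in quiver_embedding) presented_algebra_quotient:
  assumes Q: "fin_digraph Q" "fin_digraph Q'"
    and rel: "relations Q Sp Z \<subseteq> carrier (path_algebra Q :: ('k::field, _) module)"
    and rel': "relations Q' Sp' Z' \<subseteq> carrier (path_algebra Q' :: ('k, _) module)"
    and restr: "\<And>r. r \<in> relations Q' Sp' Z' \<Longrightarrow>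
      restrict_paths r \<in> Idl\<^bsub>path_algebra Q\<^esub> (relations Q Sp Z :: (_ \<Rightarrow>\<^sub>0 'k) set)"
  shows "is_quotient_of (presented_algebra Q Sp Z :: ('k, _) module) (presented_algebra Q' Sp' Z')"
proof -
  let ?A = "path_algebra Q :: ('k, _) module" and ?A' = "path_algebra Q' :: ('k, _) module"
  define I where "I = Idl\<^bsub>?A\<^esub> (relations Q Sp Z)"
  define I' where "I' = Idl\<^bsub>?A'\<^esub> (relations Q' Sp' Z')"
  interpret A: unital_algebra ?A by (rule unital_algebra_path_algebra[OF Q(1)])
  interpret A': unital_algebra ?A' by (rule unital_algebra_path_algebra[OF Q(2)])
  have I: "ideal I ?A" unfolding I_def by (rule A.genideal_ideal[OF rel])
  have I': "ideal I' ?A'" unfolding I'_def by (rule A'.genideal_ideal[OF rel'])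
  interpret I: ideal I ?A by fact
  interpret B: unital_algebra "quot_algebra ?A I" by (rule A.quot_unital_algebra[OF I])
  have quot: "(+>\<^bsub>?A\<^esub>) I \<in> ring_hom ?A (quot_algebra ?A I)"
    using I.rcos_ring_hom unfolding ring_hom_def quot_algebra_simps .
  define h :: "_ \<Rightarrow> (('v, 'a) qpath \<Rightarrow>\<^sub>0 'k) set" where "h = (+>\<^bsub>?A\<^esub>) I \<circ> restrict_paths"
  have h: "h \<in> ring_hom ?A' (quot_algebra ?A I)"
    unfolding h_def by (rule ring_hom_trans[OF restrict_ring_hom quot])
  interpret h: ring_hom_ring ?A' "quot_algebra ?A I" h
    by (rule ring_hom_ringI2[OF A'.ring_axioms B.ring_axioms h])
  have zero: "\<zero>\<^bsub>quot_algebra ?A I\<^esub> = I" by (simp add: FactRing_def)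
  have "relations Q' Sp' Z' \<subseteq> a_kernel ?A' (quot_algebra ?A I) h"
  proof
    fix r :: "_ \<Rightarrow>\<^sub>0 'k" assume r: "r \<in> relations Q' Sp' Z'"
    have "h r = I" unfolding h_def comp_def
      by (rule ideal_coset_eq_self[OF I]) (use restr[OF r] in \<open>simp add: I_def\<close>)
    then show "r \<in> a_kernel ?A' (quot_algebra ?A I) h"
      using r rel' unfolding a_kernel_def' zero by blast
  qed
  then have ker: "I' \<subseteq> a_kernel ?A' (quot_algebra ?A I) h"
    unfolding I'_def by (rule A'.genideal_minimal[OF h.kernel_is_ideal])
  have "is_quotient_of (quot_algebra ?A I) (quot_algebra ?A' I')"
  proof (rule is_quotient_of_quot_algebra[OF A'.unital_algebra_axioms B.unital_algebra_axioms I' h])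
    show "h ` carrier ?A' = carrier (quot_algebra ?A I)"
      unfolding h_def image_comp[symmetric] restrict_surj
      by (auto simp: FactRing_def A_RCOSETS_def')
    show "h x = \<zero>\<^bsub>quot_algebra ?A I\<^esub>" if "x \<in> I'" for x
      using that ker unfolding a_kernel_def' by blast
    show "h (c \<odot>\<^bsub>?A'\<^esub> \<one>\<^bsub>?A'\<^esub>) = c \<odot>\<^bsub>quot_algebra ?A I\<^esub> \<one>\<^bsub>quot_algebra ?A I\<^esub>" for c
    proof -
      have "restrict_paths (c \<odot>\<^bsub>?A'\<^esub> \<one>\<^bsub>?A'\<^esub>) = c \<odot>\<^bsub>?A\<^esub> \<one>\<^bsub>?A\<^esub>"
      proof -
        have "restrict_paths \<one>\<^bsub>?A'\<^esub> = \<one>\<^bsub>?A\<^esub>" by (rule ring_hom_one[OF restrict_ring_hom])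
        then show ?thesis by (simp only: path_algebra_simps restrict_smult)
      qed
      then have "h (c \<odot>\<^bsub>?A'\<^esub> \<one>\<^bsub>?A'\<^esub>) = I +>\<^bsub>?A\<^esub> (c \<odot>\<^bsub>?A\<^esub> \<one>\<^bsub>?A\<^esub>)"
        unfolding h_def comp_def by (rule arg_cong)
      also have "\<dots> = c \<odot>\<^bsub>quot_algebra ?A I\<^esub> (I +>\<^bsub>?A\<^esub> \<one>\<^bsub>?A\<^esub>)"
        by (rule A.smult_coset[OF I A.one_closed, symmetric])
      also have "I +>\<^bsub>?A\<^esub> \<one>\<^bsub>?A\<^esub> = \<one>\<^bsub>quot_algebra ?A I\<^esub>"
        by (simp add: FactRing_def)
      finally show ?thesis .
    qed
  qed
  then show ?thesis unfolding presented_algebra_def I_def I'_def .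
qed

section \<open>Completing a clannish presentation\<close>

text \<open>The cycle is the orbit of \<open>a\<close>, listed by \<open>support p a\<close> as the
  iterates of \<open>p\<close> below the least power fixing \<open>a\<close>. In an effective cycle
  each entry determines the next one through \<open>p\<close>, which leaves only the choice of a
  starting point.\<close>

lemma effective_cycle_of_permutation:
  assumes p: "p permutes S" and S: "finite S" and a: "a \<in> S"
  defines "R \<equiv> (\<lambda>b. [b, p b]) ` S"
  shows "\<exists>cs. effective_cycle S R cs \<and> a \<in> set cs \<and>
    (\<forall>ds. effective_cycle S R ds \<and> a \<in> set ds \<longrightarrow> (\<exists>m. ds = rotate m cs))"
proof (intro exI[of _ "support p a"] conjI allI impI)
  have perm: "permutation p" using p S by (auto simp: permutation_permutes)
  define n where "n = least_power p a"
  have n: "(p ^^ n) a = a" "0 < n"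
    unfolding n_def by (rule least_power_of_permutation[OF perm])+
  let ?cs = "support p a"
  have len: "length ?cs = n" by (simp add: n_def)
  have nth: "?cs ! i = (p ^^ i) a" if "i < n" for i using that by (simp add: n_def)
  have funpow_mem: "(p ^^ i) a \<in> S" for i
    by (induction i) (use a permutes_in_image[OF p] in auto)
  show "effective_cycle S R ?cs"
    unfolding effective_cycle_def
  proof (intro conjI allI impI)
    show "?cs \<noteq> []" using n len by auto
    show "distinct ?cs" by (rule cycle_of_permutation[OF perm])
    show "set ?cs \<subseteq> S" using funpow_mem by auto
    fix i assume "i < length ?cs"
    then have i: "i < n" using len by simp
    \<comment> \<open>At the last position the index wraps around to 0, and the orbit closes because
      the \<open>n\<close>-th iterate fixes \<open>a\<close>.\<close>
    have "?cs ! (Suc i mod n) = p (?cs ! i)"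
    proof (cases "Suc i = n")
      case True
      then have "p ((p ^^ i) a) = a" using n(1) by auto
      then show ?thesis using True nth[of 0] nth[OF i] n(2) by simp
    next
      case False
      then show ?thesis using i nth[of "Suc i"] nth[OF i] by simp
    qed
    then show "[?cs ! i, ?cs ! (Suc i mod length ?cs)] \<in> R"
      unfolding len R_def using nth[OF i] funpow_mem by auto
  qed
  show "a \<in> set ?cs" using nth[of 0] n(2) len by (metis funpow_0 nth_mem)
  fix ds assume ds: "effective_cycle S R ds \<and> a \<in> set ds"
  define m where "m = length ds"
  have m: "0 < m" "distinct ds" "\<And>i. i < m \<Longrightarrow> ds ! (Suc i mod m) = p (ds ! i)"
    using ds by (auto simp: effective_cycle_def R_def m_def)
  obtain j where j: "j < m" "ds ! j = a" using ds by (auto simp: in_set_conv_nth m_def)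
  \<comment> \<open>Read cyclically from the position \<open>j\<close> of \<open>a\<close>,
    \<open>ds\<close> runs through the iterates of \<open>a\<close>.\<close>
  have ds_nth: "ds ! ((j + i) mod m) = (p ^^ i) a" for i
  proof (induction i)
    case (Suc i)
    have "ds ! ((j + Suc i) mod m) = ds ! (Suc ((j + i) mod m) mod m)" by (simp add: mod_Suc_eq)
    then show ?case using m(1) m(3)[of "(j + i) mod m"] Suc.IH by simp
  qed (use j in simp)
  have "(p ^^ m) a = a" using ds_nth[of m] j by simp
  then have "n \<le> m" unfolding n_def by (intro least_power_le m(1))
  \<comment> \<open>Otherwise \<open>a\<close> would occur again \<open>n\<close> places after
    \<open>j\<close>, contradicting distinctness.\<close>
  moreover have "\<not> n < m"
  proof
    assume "n < m"
    have "ds ! ((j + n) mod m) = ds ! j" using ds_nth[of n] n(1) j by simp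
    then have "(j + n) mod m = j" 
      using nth_eq_iff_index_eq[OF m(2), of "(j + n) mod m" j] m(1) j by (simp add: m_def)
    then show False using \<open>n < m\<close> n(2) j(1) by (cases "j + n < m") (auto simp: le_mod_geq)
  qed
  ultimately have "m = n" by simp
  then have "rotate j ds = ?cs"
    using ds_nth nth len by (intro nth_equalityI) (auto simp: m_def nth_rotate)
  \<comment> \<open>Another \<open>m - j\<close> places complete a full turn, which expresses
    \<open>ds\<close> as a rotation of the orbit.\<close>
  then have "rotate (m - j) ?cs = rotate ((m - j) + j) ds" by (metis rotate_rotate)
  then have "ds = rotate (m - j) ?cs" using j by (simp add: m_def)
  then show "\<exists>m. ds = rotate m ?cs" ..
qed

text \<open>With two elements on each side there are two perfect matchings, and a partial matching
  \<open>r\<close> cannot meet both. With one element on each side there is no choice, which is why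
  \<open>single\<close> excludes \<open>r\<close> there.\<close>

lemma matching_avoiding_partial_matching:
  assumes "finite A" "finite B" "card A = card B" "card A \<le> 2"
    and row: "\<And>a b b'. \<lbrakk>a \<in> A; b \<in> B; b' \<in> B; r a b; r a b'\<rbrakk> \<Longrightarrow> b = b'"
    and col: "\<And>a a' b. \<lbrakk>a \<in> A; a' \<in> A; b \<in> B; r a b; r a' b\<rbrakk> \<Longrightarrow> a = a'"
    and single: "\<And>a b. \<lbrakk>card A = 1; a \<in> A; b \<in> B\<rbrakk> \<Longrightarrow> \<not> r a b"
  shows "\<exists>f. bij_betw f A B \<and> (\<forall>a\<in>A. \<not> r a (f a))"
proof -
  consider "card A = 0" | "card A = 1" | "card A = 2" using assms(4) by linarith
  then show ?thesis
  proof cases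
    case 1
    then show ?thesis using assms(1-3) by (auto simp: bij_betw_def)
  next
    case 2
    obtain a b where "A = {a}" "B = {b}" using 2 assms(3) by (metis card_1_singletonE)
    then show ?thesis using single[OF 2] by (intro exI[of _ "\<lambda>_. b"]) (auto simp: bij_betw_def)
  next
    case 3
    obtain a a' b b' where A: "A = {a, a'}" "a \<noteq> a'" and B: "B = {b, b'}" "b \<noteq> b'"
      using 3 assms(3) by (metis card_2_iff)
    show ?thesis
    proof (cases "r a b \<or> r a' b'")
      case True
      have mem: "a \<in> A" "a' \<in> A" "b \<in> B" "b' \<in> B" using A B by auto
      \<comment> \<open>Each of these two pairs shares a row or a column with whichever diagonal
        pair is related.\<close>
      have "\<not> r a b' \<and> \<not> r a' b"
        using True A(2) B(2) row[OF mem(1,3,4)] row[OF mem(2,4,3)] col[OF mem(1,2,3)] col[OF mem(1,2,4)]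
        by blast
      then show ?thesis using A B
        by (intro exI[of _ "\<lambda>x. if x = a then b' else b"]) (auto simp: bij_betw_def inj_on_def)
    next
      case False
      then show ?thesis using A B
        by (intro exI[of _ "\<lambda>x. if x = a then b else b'"]) (auto simp: bij_betw_def inj_on_def)
    qed
  qed
qed

section \<open>Adding arrows to reach constant in- and out-degree\<close>

lemma ex_list_with_multiplicities:
  assumes "finite V"
  shows "\<exists>xs. set xs \<subseteq> V \<and> length xs = sum d V \<and> (\<forall>v\<in>V. card {i. i < length xs \<and> xs ! i = v} = d v)"
proof -
  have "\<exists>xs. set xs \<subseteq> V \<and> length xs = sum d V \<and> (\<forall>v\<in>V. count_list xs v = d v)"
    using assms
  proof induction
    case (insert v V)
    then obtain xs where "set xs \<subseteq> V" "length xs = sum d V" "\<forall>v\<in>V. count_list xs v = d v" by blast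
    moreover have "count_list xs v = 0" using insert calculation by (auto simp: count_list_0_iff)
    moreover have "count_list (replicate k v) w = (if w = v then k else 0)" for k w
      by (induction k) auto
    ultimately show ?case using insert
      by (intro exI[of _ "xs @ replicate (d v) v"]) auto
  qed simp
  moreover have "card {i. i < length xs \<and> xs ! i = v} = count_list xs v" for xs and v :: 'a
    by (simp add: count_list_eq_length_filter length_filter_conv_card eq_commute)
  ultimately show ?thesis by simp
qed

text \<open>The arrows of \<open>Q\<close> and \<open>Q'\<close> may have different types, so the
  comparison uses the vertex pairs of the symmetrised digraphs.\<close>

lemma connected_mono:
  assumes "Digraph_Component.connected Q" "verts Q' = verts Q"
    and "parcs (mk_symmetric Q) \<subseteq> parcs (mk_symmetric Q')"
  shows "Digraph_Component.connected Q'"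
  using assms rtrancl_on_mono[OF assms(3) order_refl]
  by (auto simp: connected_def strongly_connected_def reachable_def)

lemma (in fin_digraph) sum_degrees:
  "(\<Sum>v\<in>verts G. in_degree G v) = card (arcs G)" "(\<Sum>v\<in>verts G. out_degree G v) = card (arcs G)"
proof -
  have "card (\<Union>v\<in>verts G. in_arcs G v) = (\<Sum>v\<in>verts G. in_degree G v)"
    "card (\<Union>v\<in>verts G. out_arcs G v) = (\<Sum>v\<in>verts G. out_degree G v)"
    unfolding in_degree_def out_degree_def by (auto intro!: card_UN_disjoint)
  moreover have "(\<Union>v\<in>verts G. in_arcs G v) = arcs G" "(\<Union>v\<in>verts G. out_arcs G v) = arcs G" by auto
  ultimately show "(\<Sum>v\<in>verts G. in_degree G v) = card (arcs G)"
    "(\<Sum>v\<in>verts G. out_degree G v) = card (arcs G)" by simp_all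
qed

text \<open>The missing in-degrees and the missing out-degrees have the same total \<open>n\<close>.
  The lists \<open>hs\<close> and \<open>ts\<close> contain each vertex as often as it lacks a head
  or a tail, and pairing them by position yields the new arrows.\<close>

lemma (in fin_digraph) ex_regular_extension:
  assumes "\<And>v. v \<in> verts G \<Longrightarrow> in_degree G v \<le> d \<and> out_degree G v \<le> d"
  shows "\<exists>(H :: ('a, 'b + nat) pre_digraph). fin_digraph H \<and> verts H = verts G \<and>
    Inl -` arcs H = arcs G \<and> tail H \<circ> Inl = tail G \<and> head H \<circ> Inl = head G \<and>
    (\<forall>v\<in>verts H. in_degree H v = d \<and> out_degree H v = d)"
proof -
  define n where "n = d * card (verts G) - card (arcs G)"
  \<comment> \<open>The degree bounds ensure that no subtraction of natural numbers is
    truncated.\<close>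
  have "(\<Sum>v\<in>verts G. d - in_degree G v) = n" "(\<Sum>v\<in>verts G. d - out_degree G v) = n"
    using assms by (simp_all add: sum_subtractf_nat sum_degrees n_def mult.commute)
  moreover obtain hs where "set hs \<subseteq> verts G" "length hs = (\<Sum>v\<in>verts G. d - in_degree G v)"
      "\<forall>v\<in>verts G. card {i. i < length hs \<and> hs ! i = v} = d - in_degree G v"
    using ex_list_with_multiplicities[OF finite_verts, of "\<lambda>v. d - in_degree G v"] by (elim exE conjE)
  moreover obtain ts where "set ts \<subseteq> verts G" "length ts = (\<Sum>v\<in>verts G. d - out_degree G v)"
      "\<forall>v\<in>verts G. card {i. i < length ts \<and> ts ! i = v} = d - out_degree G v"
    using ex_list_with_multiplicities[OF finite_verts, of "\<lambda>v. d - out_degree G v"] by (elim exE conjE)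
  ultimately have hs: "set hs \<subseteq> verts G" "length hs = n"
      "\<And>v. v \<in> verts G \<Longrightarrow> card {i. i < n \<and> hs ! i = v} = d - in_degree G v"
    and ts: "set ts \<subseteq> verts G" "length ts = n"
      "\<And>v. v \<in> verts G \<Longrightarrow> card {i. i < n \<and> ts ! i = v} = d - out_degree G v"
    by auto
  \<comment> \<open>The new arrow \<open>Inr i\<close> runs from \<open>ts ! i\<close> to
    \<open>hs ! i\<close>; on \<open>Inl\<close> the maps agree with those of \<open>G\<close>
    everywhere.\<close>
  define H :: "('a, 'b + nat) pre_digraph" where "H = \<lparr>verts = verts G, arcs = arcs G <+> {..<n},
    tail = case_sum (tail G) ((!) ts), head = case_sum (head G) ((!) hs)\<rparr>"
  have H [simp]: "verts H = verts G" "arcs H = arcs G <+> {..<n}"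
    "tail H = case_sum (tail G) ((!) ts)" "head H = case_sum (head G) ((!) hs)"
    by (simp_all add: H_def)
  have "fin_digraph H"
  proof
    fix e assume e: "e \<in> arcs H"
    show "tail H e \<in> verts H" "head H e \<in> verts H"
      using e hs(1,2) ts(1,2) by (auto simp: subset_iff)
  qed simp_all
  moreover have "in_degree H v = d" "out_degree H v = d" if v: "v \<in> verts G" for v
  proof -
    have arcs: "in_arcs H v = in_arcs G v <+> {i. i < n \<and> hs ! i = v}"
        "out_arcs H v = out_arcs G v <+> {i. i < n \<and> ts ! i = v}"
      by (auto simp: in_arcs_def out_arcs_def)
    show "in_degree H v = d"
      using assms[OF v] hs(3)[OF v] unfolding in_degree_def arcs by (subst card_Plus) auto
    show "out_degree H v = d"
      using assms[OF v] ts(3)[OF v] unfolding out_degree_def arcs by (subst card_Plus) auto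
  qed
  ultimately show ?thesis by (intro exI[of _ H]) auto
qed

section \<open>Gluing the matchings at the vertices to a permutation of the ordinary arrows\<close>

context clannish
begin

text \<open>Each ordinary arrow is incoming at exactly one vertex and outgoing at exactly one, so
  bijections from \<open>IN v\<close> to \<open>OUT v\<close>, chosen vertex by vertex, fit together
  to a permutation.\<close>

lemma ex_relation_permutation:
  fixes H :: "('v, 'a + nat) pre_digraph"
  assumes "fin_digraph H" and arcs: "Inl -` arcs H = arcs Q"
    and tail: "\<And>a. tail H (Inl a) = tail Q a" and head: "\<And>a. head H (Inl a) = head Q a"
    and deg: "\<forall>v\<in>verts H. in_degree H v = 2 \<and> out_degree H v = 2"
  shows "\<exists>p. p permutes arcs H - Inl ` Sp \<and>
    (\<forall>b\<in>arcs H - Inl ` Sp. head H b = tail H (p b)) \<and>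
    (\<forall>a\<in>ordinary. \<forall>c\<in>ordinary. p (Inl a) = Inl c \<longrightarrow> [a, c] \<in> Z)"
proof -
  interpret H: fin_digraph H by fact
  define S where "S = arcs H - Inl ` Sp"
  \<comment> \<open>The pairs to be avoided. A pair that involves a new arrow \<open>Inr i\<close>
    is never among them.\<close>
  define r where "r x y \<longleftrightarrow> (\<exists>a c. x = Inl a \<and> y = Inl c \<and> [a, c] \<notin> Z)" for x y :: "'a + nat"
  define IN where "IN v = {b\<in>S. head H b = v}" for v
  define OUT where "OUT v = {b\<in>S. tail H b = v}" for v
  define Spv where "Spv v = {e\<in>Sp. tail Q e = v}" for v
  have Sp_arcs: "Inl ` Sp \<subseteq> arcs H" using special_arcs arcs by auto
  have fin: "finite (IN v)" "finite (OUT v)" "finite (Spv v)" for v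
    using finite_subset[OF special_arcs] by (auto simp: IN_def OUT_def Spv_def S_def)
  \<comment> \<open>A special loop at \<open>v\<close> uses up one incoming and one outgoing place,
    so \<open>IN v\<close> and \<open>OUT v\<close> are equally large.\<close>
  have card: "card (IN v) + card (Spv v) = 2" "card (OUT v) + card (Spv v) = 2" if "v \<in> verts H" for v
  proof -
    have "in_arcs H v = IN v \<union> Inl ` Spv v" "out_arcs H v = OUT v \<union> Inl ` Spv v"
      using Sp_arcs special_loop
      by (auto simp: in_arcs_def out_arcs_def IN_def OUT_def Spv_def S_def tail head)
    moreover have "IN v \<inter> Inl ` Spv v = {}" "OUT v \<inter> Inl ` Spv v = {}"
      by (auto simp: IN_def OUT_def Spv_def S_def)
    ultimately have "in_degree H v = card (IN v) + card (Inl ` Spv v :: ('a + nat) set)"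
      "out_degree H v = card (OUT v) + card (Inl ` Spv v :: ('a + nat) set)"
      unfolding in_degree_def out_degree_def using fin by (simp_all add: card_Un_disjoint)
    then show "card (IN v) + card (Spv v) = 2" "card (OUT v) + card (Spv v) = 2"
      using deg that by (simp_all add: card_image)
  qed
  have S_Inl: "a \<in> ordinary" if "Inl a \<in> S" for a using that arcs by (auto simp: S_def)
  have "\<exists>f. bij_betw f (IN v) (OUT v) \<and> (\<forall>b\<in>IN v. \<not> r b (f b))" if v: "v \<in> verts H" for v
  proof (rule matching_avoiding_partial_matching)
    show "finite (IN v)" "finite (OUT v)" by (rule fin)+
    show "card (IN v) = card (OUT v)" "card (IN v) \<le> 2" using card[OF v] by linarith+
  next
    fix x y y' assume "x \<in> IN v" "y \<in> OUT v" "y' \<in> OUT v" "r x y" "r x y'"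
    then obtain a c c' where *: "x = Inl a" "y = Inl c" "y' = Inl c'" "[a, c] \<notin> Z" "[a, c'] \<notin> Z"
        "a \<in> ordinary" "c \<in> ordinary" "c' \<in> ordinary" "tail Q c = head Q a" "tail Q c' = head Q a"
      using S_Inl by (auto simp: r_def IN_def OUT_def tail head)
    then show "y = y'" using C3_after[of a] by (auto dest: Uniq_D)
  next
    fix x x' y assume "x \<in> IN v" "x' \<in> IN v" "y \<in> OUT v" "r x y" "r x' y"
    then obtain a a' c where *: "x = Inl a" "x' = Inl a'" "y = Inl c" "[a, c] \<notin> Z" "[a', c] \<notin> Z"
        "a \<in> ordinary" "a' \<in> ordinary" "c \<in> ordinary" "head Q a = tail Q c" "head Q a' = tail Q c"
      using S_Inl by (auto simp: r_def IN_def OUT_def tail head)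
    then show "x = x'" using C3_before[of c] by (auto dest: Uniq_D)
  next
    fix x y assume 1: "card (IN v) = 1" and "x \<in> IN v" "y \<in> OUT v"
    \<comment> \<open>The other incoming arrow is a special loop \<open>e\<close>, and \<open>[a, e] \<notin> Z\<close> uses up the exception allowed by (C3).\<close>
    show "\<not> r x y"
    proof
      assume "r x y"
      then obtain a c where *: "[a, c] \<notin> Z" "a \<in> ordinary" "c \<in> ordinary" "tail Q c = v" "head Q a = v"
        using S_Inl \<open>x \<in> IN v\<close> \<open>y \<in> OUT v\<close> by (auto simp: r_def IN_def OUT_def tail head)
      have "card (Spv v) = 1" using card(1)[OF v] 1 by simp
      then obtain e where "e \<in> Spv v" by (metis card_1_singletonE insertI1)
      then have e: "e \<in> Sp" "tail Q e = v" by (auto simp: Spv_def)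
      then have "[a, e] \<notin> Z" using C1_ends[of "[a, e]"] by auto
      then have "c = e" using C3_after[of a] * e special_arcs by (auto dest: Uniq_D)
      then show False using * e by simp
    qed
  qed
  then obtain f where f: "\<And>v. v \<in> verts H \<Longrightarrow> bij_betw (f v) (IN v) (OUT v)"
    "\<And>v b. v \<in> verts H \<Longrightarrow> b \<in> IN v \<Longrightarrow> \<not> r b (f v b)" by metis
  \<comment> \<open>The identity outside \<open>S\<close> is what \<open>permutes\<close>
    demands.\<close>
  define p where "p b = (if b \<in> S then f (head H b) b else b)" for b
  have b: "head H b \<in> verts H" "b \<in> IN (head H b)" if "b \<in> S" for b
    using that by (auto simp: S_def IN_def)
  have p: "p b \<in> OUT (head H b)" "\<not> r b (p b)" if "b \<in> S" for b
    using bij_betwE[OF f(1)[OF b(1)]] f(2)[OF b] b that by (auto simp: p_def)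
  have "inj_on p S"
  proof (rule inj_onI)
    fix b c assume bc: "b \<in> S" "c \<in> S" "p b = p c"
    \<comment> \<open>The tail of \<open>p b\<close> is the head of \<open>b\<close>, so the image
      determines which matching was used.\<close>
    then have "head H b = head H c" using p(1)[of b] p(1)[of c] by (auto simp: OUT_def)
    moreover have "inj_on (f (head H b)) (IN (head H b))"
      using f(1)[OF b(1)[OF bc(1)]] by (rule bij_betw_imp_inj_on)
    ultimately show "b = c"
      using bc b[OF bc(1)] b[OF bc(2)] by (auto simp: p_def dest: inj_onD)
  qed
  moreover have "p ` S \<subseteq> S" using p(1) by (auto simp: OUT_def)
  moreover have "finite S" by (simp add: S_def)
  ultimately have "bij_betw p S S" by (simp add: bij_betw_def endo_inj_surj)
  then have "p permutes S" by (rule bij_imp_permutes) (simp add: p_def)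
  moreover have "head H b = tail H (p b)" if "b \<in> S" for b using p(1)[OF that] by (simp add: OUT_def)
  moreover have "[a, c] \<in> Z" if "a \<in> ordinary" "p (Inl a) = Inl c" for a c
  proof -
    have "Inl a \<in> S" using that(1) arcs by (auto simp: S_def)
    from p(2)[OF this] that(2) show ?thesis by (auto simp: r_def)
  qed
  ultimately show ?thesis unfolding S_def by blast
qed

end

section \<open>The presentation of the complete algebra and its quotient\<close>

lemma (in quiver_with_special_loops) relations_subset_carrier:
  assumes "\<And>p. p \<in> Z \<Longrightarrow> (tail Q (hd p), p) \<in> paths Q"
  shows "relations Q Sp Z \<subseteq> carrier (path_algebra Q :: ('k::field, _) module)"
proof -
  have "Poly_Mapping.keys (path_elem Q p :: _ \<Rightarrow>\<^sub>0 'k) \<subseteq> paths Q" if "p \<in> Z" for p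
    using assms[OF that] by (simp add: path_elem_def)
  moreover have "Poly_Mapping.keys (path_elem Q [e, e] - path_elem Q [e] :: _ \<Rightarrow>\<^sub>0 'k) \<subseteq> paths Q" if "e \<in> Sp" for e
  proof -
    have "(tail Q e, [e, e]) \<in> paths Q" "(tail Q e, [e]) \<in> paths Q"
      using that special_arcs special_loop[OF that] by (auto simp: pre_digraph.cas.simps)
    then show ?thesis
      using keys_diff[of "path_elem Q [e, e]" "path_elem Q [e] :: _ \<Rightarrow>\<^sub>0 'k"] by (auto simp: path_elem_def)
  qed
  ultimately show ?thesis unfolding relations_def by auto
qed

theorem lemma4p2:
  fixes Q :: "('v, 'a) pre_digraph"
    and Sp :: "'a set"
    and Z :: "'a list set"
    and \<Lambda> :: "('k::{alg_closed_field, field_char_0}, (('v, 'a) qpath \<Rightarrow>\<^sub>0 'k) set) module"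
  assumes "clannish Q Sp Z"
    and "\<Lambda> = presented_algebra Q Sp Z"
    and "finite_dimensional \<Lambda>"
  shows "\<exists>(Qs :: ('v, 'a + nat) pre_digraph) Sps Rs.
    complete_skewed_gentle Qs Sps Rs \<and>
    verts Qs = verts Q \<and>
    subquiver_via Inl Q Qs \<and>
    is_quotient_of \<Lambda>
      (presented_algebra Qs Sps Rs :: ('k, (('v, 'a + nat) qpath \<Rightarrow>\<^sub>0 'k) set) module)"
proof -
  interpret clannish Q Sp Z by fact
  obtain Qs :: "('v, 'a + nat) pre_digraph" where Qs: "fin_digraph Qs" "verts Qs = verts Q"
      "Inl -` arcs Qs = arcs Q" "tail Qs \<circ> Inl = tail Q" "head Qs \<circ> Inl = head Q"
      "\<forall>v\<in>verts Qs. in_degree Qs v = 2 \<and> out_degree Qs v = 2"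
    using ex_regular_extension[of 2] C2 by blast
  have ends: "tail Qs (Inl a) = tail Q a" "head Qs (Inl a) = head Q a" for a
    using Qs(4,5) by (simp_all add: fun_eq_iff)
  interpret Qs: fin_digraph Qs by fact
  \<comment> \<open>Every new arrow is ordinary, even if it is a loop.\<close>
  define Sps :: "('a + nat) set" where "Sps = Inl ` Sp"
  define S where "S = arcs Qs - Sps"
  obtain p where p: "p permutes S" and p_path: "\<And>b. b \<in> S \<Longrightarrow> head Qs b = tail Qs (p b)"
    and p_Z: "\<And>a c. a \<in> ordinary \<Longrightarrow> c \<in> ordinary \<Longrightarrow> p (Inl a) = Inl c \<Longrightarrow> [a, c] \<in> Z"
    using ex_relation_permutation[OF Qs(1,3) ends Qs(6)] unfolding S_def Sps_def
    by (elim exE conjE) blast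
  define R where "R = (\<lambda>b. [b, p b]) ` S"
  have pS: "p b \<in> S" if "b \<in> S" for b using permutes_in_image[OF p] that by simp
  have mem_R: "[b, c] \<in> R \<longleftrightarrow> b \<in> S \<and> c = p b" for b c by (auto simp: R_def)
  have Inl_S: "Inl a \<in> S \<longleftrightarrow> a \<in> ordinary" for a using Qs(3) by (auto simp: S_def Sps_def)
  have finS: "finite S" by (simp add: S_def)
  have "Digraph_Component.connected Qs"
  proof (rule connected_mono[OF connected Qs(2)])
    show "parcs (mk_symmetric Q) \<subseteq> parcs (mk_symmetric Qs)"
    proof
      fix x assume "x \<in> parcs (mk_symmetric Q)"
      then obtain a where "a \<in> arcs Q" "x \<in> {(tail Q a, head Q a), (head Q a, tail Q a)}"
        by (auto simp: parcs_mk_symmetric)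
      then show "x \<in> parcs (mk_symmetric Qs)"
        using Qs(3) by (auto simp: parcs_mk_symmetric ends intro!: bexI[of _ "Inl a"])
    qed
  qed
  then interpret Qs: quiver Qs by unfold_locales
  interpret Qs: quiver_with_special_loops Qs Sps
    using special_arcs special_loop Qs(3) by unfold_locales (auto simp: Sps_def ends)
  have csg: "complete_skewed_gentle Qs Sps R"
  proof
    show "finite R" by (simp add: R_def finS)
    show "\<exists>a\<in>Qs.ordinary. \<exists>b\<in>Qs.ordinary. head Qs a = tail Qs b \<and> q = [a, b]" if "q \<in> R" for q
      using that pS p_path unfolding S_def[symmetric] R_def by blast
    show "in_degree Qs v = 2 \<and> out_degree Qs v = 2" if "v \<in> verts Qs" for v
      using Qs(6) that by blast
    show "\<exists>cs. effective_cycle Qs.ordinary R cs \<and> b \<in> set cs \<and>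
        (\<forall>ds. effective_cycle Qs.ordinary R ds \<and> b \<in> set ds \<longrightarrow> (\<exists>m. ds = rotate m cs))"
      if "b \<in> Qs.ordinary" for b
      using effective_cycle_of_permutation[OF p finS] that unfolding S_def[symmetric] R_def by blast
    show "\<exists>!c. c \<in> Qs.ordinary \<and> [c, b] \<in> R" if "b \<in> Qs.ordinary" for b
    proof -
      have b: "b \<in> S" using that by (simp add: S_def)
      then obtain c where c: "b = p c" "c \<in> S" using permutes_image[OF p] by blast
      have "c' = c" if "p c' = b" for c'
        using that c(1) permutes_inj[OF p] by (auto dest: injD)
      then show ?thesis
        using c unfolding S_def[symmetric] mem_R by (intro ex1I[of _ c]) auto
    qed
    show "\<exists>!c. c \<in> Qs.ordinary \<and> [b, c] \<in> R" if "b \<in> Qs.ordinary" for b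
      using that pS unfolding S_def[symmetric] mem_R by blast
    show "hd q \<notin> Sps \<and> last q \<notin> Sps" if "q \<in> R" for q
    proof -
      obtain b where "q = [b, p b]" "b \<in> S" using \<open>q \<in> R\<close> by (auto simp: R_def)
      then show ?thesis using pS[of b] by (simp add: S_def)
    qed
  qed
  have emb: "quiver_embedding Inl Q Qs"
    by unfold_locales (use Qs ends in auto)
  interpret quiver_embedding Inl Q Qs by (rule emb)
  have rel: "relations Q Sp Z \<subseteq> carrier (path_algebra Q :: ('k, _) module)"
    by (rule relations_subset_carrier) (use zero_relations in blast)
  have rel': "relations Qs Sps R \<subseteq> carrier (path_algebra Qs :: ('k, _) module)"
  proof (rule Qs.relations_subset_carrier)
    fix q assume "q \<in> R"
    then obtain b where "b \<in> S" "q = [b, p b]" by (auto simp: R_def)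
    then show "(tail Qs (hd q), q) \<in> paths Qs"
      using pS[of b] p_path[of b] by (auto simp: S_def pre_digraph.cas.simps)
  qed
  let ?I = "Idl\<^bsub>path_algebra Q\<^esub> (relations Q Sp Z) :: (('v, 'a) qpath \<Rightarrow>\<^sub>0 'k) set"
  interpret A: unital_algebra "path_algebra Q :: ('k, _) module"
    by (rule unital_algebra_path_algebra) unfold_locales
  have I: "relations Q Sp Z \<subseteq> ?I" by (rule A.genideal_self[OF rel])
  have zero: "0 \<in> ?I"
    using additive_subgroup.zero_closed[OF ideal.axioms(1)[OF A.genideal_ideal[OF rel]]] by simp
  \<comment> \<open>\<open>path_elem\<close> takes the start vertex from the first arrow, hence the
    restriction to nonempty \<open>q\<close>.\<close>
  have restrict_elem: "restrict_paths (path_elem Qs (map Inl q)) = (path_elem Q q :: _ \<Rightarrow>\<^sub>0 'k)"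
    if "q \<noteq> []" for q
    using that by (simp add: path_elem_def hd_map ends)
  have restr: "restrict_paths r \<in> ?I" if "r \<in> relations Qs Sps R" for r
  proof -
    from that consider (special) e where "e \<in> Sp" "r = path_elem Qs [Inl e, Inl e] - path_elem Qs [Inl e]"
      | (zero) b where "b \<in> S" "r = path_elem Qs [b, p b]"
      by (auto simp: relations_def Sps_def R_def)
    then show ?thesis
    proof cases
      case special
      then have "restrict_paths r = path_elem Q [e, e] - path_elem Q [e]"
        using restrict_elem[of "[e, e]"] restrict_elem[of "[e]"] by (simp add: restrict_diff)
      then show ?thesis using special(1) I by (auto simp: relations_def)
    next
      case (zero b)
      show ?thesis
      \<comment> \<open>If both arrows come from \<open>Q\<close>, the choice of \<open>p\<close>
        makes their product a zero-relation of \<open>Q\<close>; otherwise the path contains a new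
        arrow and restricts to zero.\<close>
      proof (cases "\<exists>a c. b = Inl a \<and> p b = Inl c")
        case True
        then obtain a c where ac: "b = Inl a" "p b = Inl c" by blast
        then have "[a, c] \<in> Z" using p_Z zero(1) pS[OF zero(1)] Inl_S by auto
        moreover have "restrict_paths r = path_elem Q [a, c]"
          using restrict_elem[of "[a, c]"] zero(2) ac by simp
        ultimately show ?thesis using I by (auto simp: relations_def)
      next
        case False
        then have "\<not> set [b, p b] \<subseteq> range Inl" by auto
        then have "restrict_paths r = 0"
          unfolding zero(2) path_elem_def by (rule restrict_single_outside)
        then show ?thesis using \<open>0 \<in> ?I\<close> by simp
      qed
    qed
  qed
  have "is_quotient_of \<Lambda> (presented_algebra Qs Sps R :: ('k, _) module)"
    unfolding assms(2)
    by (rule presented_algebra_quotient[OF _ Qs(1) rel rel' restr]) unfold_locales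
  moreover have "subquiver_via Inl Q Qs"
    using Qs(2,3) ends by (auto simp: subquiver_via_def)
  ultimately show ?thesis using csg Qs(2) by blast
qed

end
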